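(* Let $I\subseteq\mathbb{R}$ be an interval, let $a,b,c,f_2\in C^\infty(I)$ be real-valued with $c(x)\neq0$ and $f_2(x)+b^2(x)\ge 0$ on $I$, and fix a choice of sign $\pm$ (the same throughout). Suppose that the derivative below exists on $I$ and that for all $x\in I$ $$a(x)=\frac{d}{dx}\left[\frac{-b(x)\pm\sqrt{f_2(x)+b^2(x)}}{2c(x)}\right]-\frac{f_2(x)}{4c(x)} .$$ Then the general solution of the Riccati equation $\frac{dy_\pm}{dx}=a(x)+b(x)y_\pm+c(x)y_\pm^2$ is $$y_\pm(x)=\frac{e^{\pm\int^{x}\sqrt{f_2(\phi)+b^2(\phi)}\,d\phi}}{C_{\pm2}-\int^{x}c(\psi)\,e^{\pm\int^{\psi}\sqrt{f_2(\phi)+b^2(\phi)}\,d\phi}\,d\psi}+\frac{-b(x)\pm\sqrt{f_2(x)+b^2(x)}}{2c(x)},$$ where $C_{\pm2}$ is an arbitrary constant of integration.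
   Context: $\int^{x}g(\phi)\,d\phi$ denotes a fixed antiderivative of $g$ on $I$, the same one wherever the same integrand occurs. "The general solution is $y(x)=\frac{G(x)}{C-H(x)}+y_p(x)$ with $C$ an arbitrary constant" means: for every real $C$, this function satisfies the equation on every subinterval of $I$ on which $C-H$ does not vanish; and conversely every differentiable solution on a nondegenerate subinterval of $I$ is either of this form for some real $C$ (with nonvanishing denominator there) or equal to $y_p$ (the limiting case $C=\infty$). *)

theory Defs
  imports "HOL-Analysis.Analysis"
begin

text \<open>
  The interval \<^term>\<open>S\<close> may contain its endpoints, where derivatives are one-sided. The library's
  \<^const>\<open>deriv\<close> is two-sided, hence derivatives relative to \<^term>\<open>S\<close>; they are unique on \<^term>\<open>S\<close>
  unless \<^term>\<open>S\<close> is a single point.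
\<close>

fun Ck_on :: "nat \<Rightarrow> (real \<Rightarrow> real) \<Rightarrow> real set \<Rightarrow> bool" where
  "Ck_on 0 f S \<longleftrightarrow> continuous_on S f"
| "Ck_on (Suc k) f S \<longleftrightarrow>
     (\<exists>f'. (\<forall>x\<in>S. (f has_real_derivative f' x) (at x within S)) \<and> Ck_on k f' S)"

definition smooth_on :: "(real \<Rightarrow> real) \<Rightarrow> real set \<Rightarrow> bool" where
  "smooth_on f S \<longleftrightarrow> (\<forall>k. Ck_on k f S)"

definition antiderivative_on :: "(real \<Rightarrow> real) \<Rightarrow> (real \<Rightarrow> real) \<Rightarrow> real set \<Rightarrow> bool" where
  "antiderivative_on F f S \<longleftrightarrow> (\<forall>x\<in>S. (F has_real_derivative f x) (at x within S))"

definition riccati_solution_on ::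
  "(real \<Rightarrow> real) \<Rightarrow> (real \<Rightarrow> real) \<Rightarrow> (real \<Rightarrow> real) \<Rightarrow> (real \<Rightarrow> real) \<Rightarrow> real set \<Rightarrow> bool" where
  "riccati_solution_on a b c y J \<longleftrightarrow>
     (\<forall>x\<in>J. (y has_real_derivative (a x + b x * y x + c x * (y x)\<^sup>2)) (at x within J))"

end

theory Submission
  imports Defs
begin

text \<open>
  Put $r = \sqrt{f_2 + b^2}$ and $y_p = (-b + s r)/(2c)$. Completing the square,
  $b y_p + c y_p^2 = ((2 c y_p + b)^2 - b^2)/(4c) = (r^2 - b^2)/(4c) = f_2/(4c)$, so the hypothesis
  on $a$ says exactly that $y_p$ is a particular solution
  (\<open>particular_solution_square\<close>).

  A known solution $y_p$ reduces a Riccati equation to a Bernoulli equation without zeroth order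
  term: $u = y - y_p$ satisfies $u' = (b + 2 c y_p) u + c u^2$. Here $b + 2 c y_p = s r$, so
  $E = e^{s R}$ solves the linear part, and $w = u / E$ satisfies the separable equation
  $w' = c E w^2 = H' w^2$ (\<open>riccati_reduction\<close>; the converse
  direction is \<open>riccati_from_particular_solution\<close>).

  Where $w \neq 0$, the function $1/w + H$ has derivative $0$, so $w = 1/(C - H)$. It remains to
  see that a solution cannot pass from the zero solution to such a branch. The identity
  $w (C - H) = 1$ is a closed condition; wherever it holds $w$ is nonzero, hence it persists nearby.
  By connectedness it holds on the whole interval as soon as it holds at one point
  (\<open>separable_square_ode\<close>).
\<close>

text \<open>
  One point $p$ with $w(p) \neq 0$ forces the constant $C = 1/w(p) + H(p)$. The set
  where $w (C - H) = 1$ is closed by continuity, and open because dividing by $w^2$ is legitimate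
  near each of its points; so it is all of \<^term>\<open>J\<close>, and $w$ never reaches $0$.
\<close>

lemma separable_square_ode:
  fixes w H h :: "real \<Rightarrow> real"
  assumes J: "is_interval J"
    and w: "\<And>x. x \<in> J \<Longrightarrow> (w has_real_derivative h x * (w x)\<^sup>2) (at x within J)"
    and H: "\<And>x. x \<in> J \<Longrightarrow> (H has_real_derivative h x) (at x within J)"
  shows "(\<exists>C. \<forall>x\<in>J. C - H x \<noteq> 0 \<and> w x = 1 / (C - H x)) \<or> (\<forall>x\<in>J. w x = 0)"
proof (cases "\<forall>x\<in>J. w x = 0")
  case True
  then show ?thesis by blast
next
  case False
  then obtain p where p: "p \<in> J" "w p \<noteq> 0" by blast
  define C where "C = 1 / w p + H p"
  define A where "A = {x \<in> J. w x * (C - H x) = 1}"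
  have cw: "continuous_on J w" and cH: "continuous_on J H"
    using DERIV_continuous_on[OF w] DERIV_continuous_on[OF H] by blast+
  have "closedin (top_of_set J) A"
    unfolding A_def
    by (intro continuous_closedin_preimage_constant continuous_intros cw cH)
  moreover have "openin (top_of_set J) A"
    unfolding openin_contains_ball
  proof (intro conjI ballI)
    show "A \<subseteq> J" by (auto simp: A_def)
    fix q assume "q \<in> A"
    then have q: "q \<in> J" "w q * (C - H q) = 1" by (auto simp: A_def)
    then have "w q \<noteq> 0" by auto
    then obtain e where e: "e > 0" "\<And>y. y \<in> J \<Longrightarrow> dist q y < e \<Longrightarrow> w y \<noteq> 0"
      using continuous_on_avoid[OF cw q(1), of 0] by blast
    let ?B = "ball q e \<inter> J"
    have conv: "convex ?B"
      using J by (intro convex_Int convex_ball) (simp add: is_interval_convex)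
    have "\<exists>k. \<forall>x\<in>?B. 1 / w x + H x = k"
    proof (rule has_field_derivative_zero_constant[OF conv])
      fix x assume x: "x \<in> ?B"
      then have nz: "w x \<noteq> 0" using e(2) by auto
      have "(w has_real_derivative h x * (w x)\<^sup>2) (at x within ?B)"
        and "(H has_real_derivative h x) (at x within ?B)"
        using x by (auto intro: has_field_derivative_subset[OF w] has_field_derivative_subset[OF H])
      from DERIV_add[OF DERIV_inverse_fun[OF this(1) nz] this(2)]
      show "((\<lambda>x. 1 / w x + H x) has_field_derivative 0) (at x within ?B)"
        using nz by (simp add: field_simps power2_eq_square)
    qed
    then obtain k where k: "\<And>x. x \<in> ?B \<Longrightarrow> 1 / w x + H x = k" by blast
    have "k = C"
      using k[of q] q e(1) \<open>w q \<noteq> 0\<close> by (auto simp: field_simps)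
    then have "?B \<subseteq> A"
      using k e(2) by (force simp: A_def field_simps)
    then show "\<exists>e>0. ball q e \<inter> J \<subseteq> A" using e(1) by blast
  qed
  moreover have "p \<in> A" using p by (simp add: A_def C_def)
  moreover have "connected J" using J by (simp add: is_interval_connected)
  ultimately have "A = J" by (metis connected_clopen empty_iff)
  then have AJ: "w x * (C - H x) = 1" if "x \<in> J" for x
    using that by (auto simp: A_def)
  have "C - H x \<noteq> 0 \<and> w x = 1 / (C - H x)" if "x \<in> J" for x
    using AJ[OF that] by (metis mult_zero_right nonzero_eq_divide_eq zero_neq_one)
  then show ?thesis by blast
qed

text \<open>
  The linearisation of the equation at a solution $y_p$ is $u' = (b + 2 c y_p) u$, and
  \<^term>\<open>E\<close> is a solution of it. Variation of constants in the form $y = y_p + E w$ then leaves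
  only $w' = c E w^2$, of which $w = 1/(C - H)$ is a solution.
\<close>

lemma riccati_from_particular_solution:
  fixes a b c yp E H :: "real \<Rightarrow> real"
  assumes yp: "riccati_solution_on a b c yp J"
    and E: "antiderivative_on E (\<lambda>x. (b x + 2 * c x * yp x) * E x) J"
    and H: "antiderivative_on H (\<lambda>x. c x * E x) J"
    and nz: "\<And>x. x \<in> J \<Longrightarrow> C - H x \<noteq> 0"
  shows "riccati_solution_on a b c (\<lambda>x. E x / (C - H x) + yp x) J"
  unfolding riccati_solution_on_def
proof
  fix x assume x: "x \<in> J"
  note d = yp[unfolded riccati_solution_on_def, rule_format, OF x]
    E[unfolded antiderivative_on_def, rule_format, OF x]
    H[unfolded antiderivative_on_def, rule_format, OF x]
  let ?w = "E x / (C - H x)"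
  have "((b x + 2 * c x * yp x) * E x * (C - H x) + E x * (c x * E x)) / ((C - H x) * (C - H x))
      = (b x + 2 * c x * yp x) * ?w + c x * ?w\<^sup>2"
    using nz[OF x] by (simp add: add_divide_distrib power2_eq_square)
  moreover have "a x + b x * (?w + yp x) + c x * (?w + yp x)\<^sup>2
      = (b x + 2 * c x * yp x) * ?w + c x * ?w\<^sup>2 + (a x + b x * yp x + c x * (yp x)\<^sup>2)"
    by algebra
  ultimately have *: "((b x + 2 * c x * yp x) * E x * (C - H x) - E x * (0 - c x * E x))
      / ((C - H x) * (C - H x)) + (a x + b x * yp x + c x * (yp x)\<^sup>2)
      = a x + b x * (?w + yp x) + c x * (?w + yp x)\<^sup>2"
    by (simp only: diff_0 mult_minus_right diff_minus_eq_add)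
  show "((\<lambda>x. E x / (C - H x) + yp x) has_real_derivative
      a x + b x * (?w + yp x) + c x * (?w + yp x)\<^sup>2) (at x within J)"
    by (rule derivative_eq_intros d nz[OF x] refl)+ (rule *)
qed

lemma riccati_reduction:
  fixes a b c y yp E :: "real \<Rightarrow> real"
  assumes y: "riccati_solution_on a b c y J" and yp: "riccati_solution_on a b c yp J"
    and E: "antiderivative_on E (\<lambda>x. (b x + 2 * c x * yp x) * E x) J"
    and nz: "\<And>x. x \<in> J \<Longrightarrow> E x \<noteq> 0"
    and x: "x \<in> J"
  shows "((\<lambda>x. (y x - yp x) / E x) has_real_derivative
      (c x * E x) * ((y x - yp x) / E x)\<^sup>2) (at x within J)"
proof -
  note d = y[unfolded riccati_solution_on_def, rule_format, OF x]
    yp[unfolded riccati_solution_on_def, rule_format, OF x]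
    E[unfolded antiderivative_on_def, rule_format, OF x]
  show ?thesis
    by (rule derivative_eq_intros d nz[OF x] refl)+
       (use nz[OF x] in \<open>simp add: field_simps power2_eq_square\<close>)
qed

lemma riccati_general_solution:
  fixes a b c y yp E H :: "real \<Rightarrow> real"
  assumes J: "is_interval J"
    and y: "riccati_solution_on a b c y J" and yp: "riccati_solution_on a b c yp J"
    and E: "antiderivative_on E (\<lambda>x. (b x + 2 * c x * yp x) * E x) J"
    and H: "antiderivative_on H (\<lambda>x. c x * E x) J"
    and nz: "\<And>x. x \<in> J \<Longrightarrow> E x \<noteq> 0"
  shows "(\<exists>C. \<forall>x\<in>J. C - H x \<noteq> 0 \<and> y x = E x / (C - H x) + yp x) \<or> (\<forall>x\<in>J. y x = yp x)"
proof -
  have H': "(H has_real_derivative c x * E x) (at x within J)" if "x \<in> J" for x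
    using H that by (simp add: antiderivative_on_def)
  consider C where "\<forall>x\<in>J. C - H x \<noteq> 0 \<and> (y x - yp x) / E x = 1 / (C - H x)"
    | "\<forall>x\<in>J. (y x - yp x) / E x = 0"
    using separable_square_ode[OF J riccati_reduction[OF y yp E nz] H'] by blast
  then show ?thesis
  proof cases
    case 1
    then have "\<forall>x\<in>J. C - H x \<noteq> 0 \<and> y x = E x / (C - H x) + yp x"
      using nz by (fastforce simp: field_simps)
    then show ?thesis by blast
  next
    case 2
    then show ?thesis using nz by auto
  qed
qed

text \<open>
  Multiplying by $4c$ and completing the square turns the left-hand side into
  $(s r)^2 - b^2$; this is where the term $f_2/(4c)$ in the hypothesis on $a$ comes from.
\<close>

lemma particular_solution_square:
  fixes b c f r s :: real
  assumes "c \<noteq> 0" "r\<^sup>2 = f + b\<^sup>2" "s\<^sup>2 = 1"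
  shows "b * ((- b + s * r) / (2 * c)) + c * ((- b + s * r) / (2 * c))\<^sup>2 = f / (4 * c)"
proof -
  have "b * ((- b + s * r) / (2 * c)) + c * ((- b + s * r) / (2 * c))\<^sup>2
      = (s\<^sup>2 * r\<^sup>2 - b\<^sup>2) / (4 * c)"
    using assms(1) by (simp add: field_simps power2_eq_square)
  then show ?thesis using assms(2,3) by simp
qed

lemma riccati_solution_on_subset:
  "riccati_solution_on a b c y I \<Longrightarrow> J \<subseteq> I \<Longrightarrow> riccati_solution_on a b c y J"
  unfolding riccati_solution_on_def by (blast intro: has_field_derivative_subset)

lemma antiderivative_on_subset:
  "antiderivative_on F f I \<Longrightarrow> J \<subseteq> I \<Longrightarrow> antiderivative_on F f J"
  unfolding antiderivative_on_def by (blast intro: has_field_derivative_subset)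

theorem theorem2:
  fixes I :: "real set" and a b c f2 yp' R H :: "real \<Rightarrow> real" and s :: real
  assumes "is_interval I"
    and "smooth_on a I" and "smooth_on b I" and "smooth_on c I" and "smooth_on f2 I"
    and "\<forall>x\<in>I. c x \<noteq> 0"
    and "\<forall>x\<in>I. f2 x + (b x)\<^sup>2 \<ge> 0"
    and "s = 1 \<or> s = - 1"
    and "\<forall>x\<in>I. ((\<lambda>t. (- b t + s * sqrt (f2 t + (b t)\<^sup>2)) / (2 * c t))
                   has_real_derivative yp' x) (at x within I)"
    and "\<forall>x\<in>I. a x = yp' x - f2 x / (4 * c x)"
    and "antiderivative_on R (\<lambda>\<phi>. sqrt (f2 \<phi> + (b \<phi>)\<^sup>2)) I"
    and "antiderivative_on H (\<lambda>\<psi>. c \<psi> * exp (s * R \<psi>)) I"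
  shows
    "(\<forall>C J. is_interval J \<and> J \<subseteq> I \<and> (\<forall>x\<in>J. C - H x \<noteq> 0) \<longrightarrow>
        riccati_solution_on a b c
          (\<lambda>x. exp (s * R x) / (C - H x) + (- b x + s * sqrt (f2 x + (b x)\<^sup>2)) / (2 * c x)) J)
   \<and> (\<forall>J y. is_interval J \<and> J \<subseteq> I \<and> (\<exists>u\<in>J. \<exists>v\<in>J. u < v) \<and> riccati_solution_on a b c y J \<longrightarrow>
        (\<exists>C. \<forall>x\<in>J. C - H x \<noteq> 0 \<and>
           y x = exp (s * R x) / (C - H x) + (- b x + s * sqrt (f2 x + (b x)\<^sup>2)) / (2 * c x))
        \<or> (\<forall>x\<in>J. y x = (- b x + s * sqrt (f2 x + (b x)\<^sup>2)) / (2 * c x)))"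
proof -
  define r where "r x = sqrt (f2 x + (b x)\<^sup>2)" for x
  define yp where "yp x = (- b x + s * r x) / (2 * c x)" for x
  define E where "E x = exp (s * R x)" for x
  have c0: "c x \<noteq> 0" and r2: "(r x)\<^sup>2 = f2 x + (b x)\<^sup>2" if "x \<in> I" for x
    using assms(6,7) that by (auto simp: r_def)
  have s2: "s\<^sup>2 = 1" using assms(8) by auto
  have ypI: "riccati_solution_on a b c yp I"
    unfolding riccati_solution_on_def
  proof
    fix x assume x: "x \<in> I"
    have "yp' x = a x + b x * yp x + c x * (yp x)\<^sup>2"
      using particular_solution_square[OF c0[OF x] r2[OF x] s2] assms(10) x
      by (simp add: yp_def)
    moreover have "(yp has_real_derivative yp' x) (at x within I)"
      using assms(9) x by (simp add: yp_def[abs_def] r_def)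
    ultimately show "(yp has_real_derivative a x + b x * yp x + c x * (yp x)\<^sup>2) (at x within I)"
      by simp
  qed
  have EI: "antiderivative_on E (\<lambda>x. (b x + 2 * c x * yp x) * E x) I"
    unfolding antiderivative_on_def
  proof
    fix x assume x: "x \<in> I"
    have R: "(R has_real_derivative r x) (at x within I)"
      using assms(11) x by (simp add: antiderivative_on_def r_def)
    have "b x + 2 * c x * yp x = s * r x"
      using c0[OF x] by (simp add: yp_def)
    moreover have "(E has_real_derivative s * r x * E x) (at x within I)"
      unfolding E_def by (rule derivative_eq_intros R refl)+ simp
    ultimately show "(E has_real_derivative (b x + 2 * c x * yp x) * E x) (at x within I)"
      by simp
  qed
  have HI: "antiderivative_on H (\<lambda>x. c x * E x) I"
    using assms(12) by (simp add: E_def)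
  have "riccati_solution_on a b c (\<lambda>x. E x / (C - H x) + yp x) J"
    if "J \<subseteq> I" "\<forall>x\<in>J. C - H x \<noteq> 0" for C J
    using that ypI EI HI
    by (intro riccati_from_particular_solution)
       (auto intro: riccati_solution_on_subset antiderivative_on_subset)
  moreover have "(\<exists>C. \<forall>x\<in>J. C - H x \<noteq> 0 \<and> y x = E x / (C - H x) + yp x) \<or> (\<forall>x\<in>J. y x = yp x)"
    if "is_interval J" "J \<subseteq> I" "riccati_solution_on a b c y J" for J y
    using that(1,3) riccati_solution_on_subset[OF ypI that(2)]
      antiderivative_on_subset[OF EI that(2)] antiderivative_on_subset[OF HI that(2)]
    by (rule riccati_general_solution) (simp add: E_def)
  ultimately show ?thesis
    unfolding E_def yp_def r_def by blast
qed

end
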